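(* Let $G$ be an abelian group and let $\varphi\in\mathrm{End}(G)$ be surjective. The following conditions are equivalent: (i) $s(\varphi)=0$; (ii) $s(\varphi)<\infty$; (iii) $G=\mathrm{Per}(\varphi)$.
   Context: $\mathbb N=\{0,1,2,\dots\}$ and $\mathbb N_+=\mathbb N\setminus\{0\}$. For an endomorphism $\varphi$ of an abelian group $G$: $\mathrm{Per}(\varphi)$ is the set of $x\in G$ such that $\varphi^n(x)=x$ for some $n\in\mathbb N_+$. A string of $\varphi$ is a sequence $S=\{x_n\}_{n\in\mathbb N}$ of pairwise distinct elements of $G$ with $\varphi(x_n)=x_{n-1}$ for every $n\in\mathbb N_+$. The string number is $s(\varphi)=\sup\{|\mathcal F|:\mathcal F$ is a family of pairwise disjoint strings of $\varphi$ in $G\}$ (disjointness refers to the underlying sets of elements); it takes values in $\mathbb N\cup\{\infty\}$, i.e. it is set equal to $\infty$ whenever the supremum is infinite. *)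

theory Defs
  imports "HOL-Algebra.Group" "HOL-Library.Extended_Nat" "HOL-Library.Disjoint_Sets"
begin

definition Per :: "('a, 'b) monoid_scheme \<Rightarrow> ('a \<Rightarrow> 'a) \<Rightarrow> 'a set" where
  "Per G \<phi> = {x \<in> carrier G. \<exists>n::nat. n > 0 \<and> (\<phi> ^^ n) x = x}"

definition strings :: "('a, 'b) monoid_scheme \<Rightarrow> ('a \<Rightarrow> 'a) \<Rightarrow> (nat \<Rightarrow> 'a) set" where
  "strings G \<phi> = {x. range x \<subseteq> carrier G \<and> inj x \<and> (\<forall>n>0. \<phi> (x n) = x (n - 1))}"

(* card is 0 on infinite sets, so infinite families need a separate case. *)
definition ecard :: "'a set \<Rightarrow> enat" where
  "ecard A = (if finite A then enat (card A) else \<infinity>)"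

(* A family of pairwise disjoint strings is encoded as a set of strings. This loses nothing
   compared to indexed families, since disjoint strings are distinct (ranges are nonempty). *)
definition string_number :: "('a, 'b) monoid_scheme \<Rightarrow> ('a \<Rightarrow> 'a) \<Rightarrow> enat" where
  "string_number G \<phi> = Sup {ecard F |F. F \<subseteq> strings G \<phi> \<and> disjoint_family_on range F}"

end

theory Submission
  imports Defs "HOL-Algebra.Multiplicative_Group"
begin

text \<open>
  When every point is periodic there is no string at all: a string with first term \<open>x 0\<close> of
  period \<open>p\<close> has a term \<open>x p\<close> that some multiple of \<open>p\<close> steps carries both to itself and to
  \<open>x 0\<close>. So the content of the theorem is that a single nonperiodic point forces the string number
  to be infinite.

  Since \<open>\<phi>\<close> is surjective, every point has a backward orbit, and the backward orbit of a
  nonperiodic point is a string. Two such strings can meet only if one starting point lies on the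
  forward orbit of the other. Hence, if the string number is finite, every sequence of nonperiodic
  points contains two distinct indices whose terms are related by an iterate of \<open>\<phi>\<close>
  (\<open>forward_related\<close>). Everything else consists in feeding this pigeonhole principle suitable
  sequences, under the assumption that some nonperiodic point \<open>x\<close> exists. Write the group additively.

  \<^item> If \<open>k\<close> is in the kernel of \<open>\<phi>\<close>, the branches \<open>z n = x (n + 1) + k\<close> of the backward
    orbit of \<open>x\<close> are never related unless \<open>k = 0\<close>. So \<open>\<phi>\<close> is an automorphism.
  \<^item> If \<open>z\<close> is a torsion point, the sequence \<open>z + \<phi>^(b+1) z\<close> yields a relation
    \<open>z + \<phi>^a z = \<phi>^c z + \<phi>^d z\<close>. Its coefficient at the largest exponent is a unit, so
    the forward orbit of \<open>z\<close> spans a finite group and \<open>z\<close> is periodic (\<open>torsion_Per\<close>).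
  \<^item> It follows that \<open>x\<close> is periodic as soon as some positive multiple of it is
    (\<open>Per_if_pow_Per\<close>): for \<open>x\<close> nonperiodic, all positive multiples of \<open>x\<close> are nonperiodic.
  \<^item> The sequences \<open>2^i x\<close> and \<open>3^i x\<close> now make \<open>x\<close> an eigenvector of two iterates of
    \<open>\<phi>\<close>, the eigenvalues being nontrivial rational powers of 2 and of 3. Comparing these on a common
    iterate gives two distinct integers \<open>M\<close> and \<open>N\<close> with \<open>M x = N x\<close>; if one of the iterates is
    the identity, its eigenvalue equation already has this form. So \<open>x\<close> is torsion,
    hence periodic, a contradiction.
\<close>

section \<open>Multiplicative independence of 2 and 3\<close>

lemma pow2_mult_pow3_unique:
  fixes a b c d :: nat
  assumes "(2::nat) ^ a * 3 ^ b = 2 ^ c * 3 ^ d"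
  shows "a = c"
proof -
  have "a \<le> c" if "(2::nat) ^ a * 3 ^ b = 2 ^ c * 3 ^ d" for a b c d
  proof -
    have "(2::nat) ^ a dvd 2 ^ c * 3 ^ d"
      using that by (metis dvd_triv_left)
    moreover have "coprime ((2::nat) ^ a) (3 ^ d)" by simp
    ultimately have "(2::nat) ^ a dvd 2 ^ c"
      by (simp only: coprime_dvd_mult_left_iff)
    then show ?thesis by (simp add: dvd_power_iff_le)
  qed
  from this[OF assms] this[OF assms[symmetric]] show ?thesis by simp
qed

section \<open>Surjective endomorphisms and periodic points\<close>

locale surjective_endomorphism = comm_group G for G (structure) +
  fixes \<phi> :: "'a \<Rightarrow> 'a"
  assumes endo: "\<phi> \<in> hom G G"
    and surj: "\<phi> ` carrier G = carrier G"
begin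

lemma iterate_hom: "\<phi> ^^ n \<in> hom G G"
proof (induction n)
  case 0
  then show ?case by (simp add: hom_def)
next
  case (Suc n)
  then show ?case using endo by (auto simp: hom_def Pi_iff)
qed

lemma iterate_closed [simp]: "x \<in> carrier G \<Longrightarrow> (\<phi> ^^ n) x \<in> carrier G"
  using iterate_hom by (auto simp: hom_def)

lemma endo_closed [simp]: "x \<in> carrier G \<Longrightarrow> \<phi> x \<in> carrier G"
  using endo by (auto simp: hom_def)

lemma iterate_mult:
  "x \<in> carrier G \<Longrightarrow> y \<in> carrier G \<Longrightarrow> (\<phi> ^^ n) (x \<otimes> y) = (\<phi> ^^ n) x \<otimes> (\<phi> ^^ n) y"
  using iterate_hom by (auto simp: hom_def)

lemma iterate_pow:
  "x \<in> carrier G \<Longrightarrow> (\<phi> ^^ n) (x [^] (k::nat)) = (\<phi> ^^ n) x [^] k"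
proof -
  interpret h: group_hom G G "\<phi> ^^ n"
    using iterate_hom by unfold_locales
  show "x \<in> carrier G \<Longrightarrow> (\<phi> ^^ n) (x [^] (k::nat)) = (\<phi> ^^ n) x [^] k"
    by (rule h.hom_nat_pow)
qed

lemma iterate_add: "(\<phi> ^^ m) ((\<phi> ^^ n) x) = (\<phi> ^^ (m + n)) x"
  by (simp add: funpow_add)

lemma iterate_fixed: "(\<phi> ^^ n) x = x \<Longrightarrow> (\<phi> ^^ (n * k)) x = x"
  by (induction k) (simp_all add: funpow_add)

lemma PerI: "x \<in> carrier G \<Longrightarrow> n > 0 \<Longrightarrow> (\<phi> ^^ n) x = x \<Longrightarrow> x \<in> Per G \<phi>"
  by (auto simp: Per_def)

lemma PerE:
  assumes "x \<in> Per G \<phi>"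
  obtains n where "x \<in> carrier G" "n > 0" "(\<phi> ^^ n) x = x"
  using assms by (auto simp: Per_def)

lemma iterate_Per: "x \<in> Per G \<phi> \<Longrightarrow> (\<phi> ^^ n) x \<in> Per G \<phi>"
proof (erule PerE)
  fix p assume p: "x \<in> carrier G" "p > 0" "(\<phi> ^^ p) x = x"
  have "(\<phi> ^^ p) ((\<phi> ^^ n) x) = (\<phi> ^^ n) ((\<phi> ^^ p) x)"
    by (simp only: iterate_add add.commute)
  with p show ?thesis by (auto intro: PerI)
qed

section \<open>Backward orbits as strings\<close>

definition ray :: "'a \<Rightarrow> nat \<Rightarrow> 'a" where
  "ray x n = (inv_into (carrier G) \<phi> ^^ n) x"

lemma ray_0 [simp]: "ray x 0 = x"
  by (simp add: ray_def)

lemma ray_closed [simp]: "x \<in> carrier G \<Longrightarrow> ray x n \<in> carrier G"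
  by (induction n) (simp_all add: ray_def inv_into_into surj)

lemma endo_ray [simp]: "x \<in> carrier G \<Longrightarrow> \<phi> (ray x (Suc n)) = ray x n"
  using ray_closed[of x n] by (simp add: ray_def f_inv_into_f surj)

lemma iterate_ray: "x \<in> carrier G \<Longrightarrow> (\<phi> ^^ n) (ray x (n + m)) = ray x m"
proof (induction n arbitrary: m)
  case (Suc n)
  then have "(\<phi> ^^ n) (ray x (n + Suc m)) = ray x (Suc m)" by blast
  with Suc show ?case by simp
qed simp

lemma iterate_ray_self: "x \<in> carrier G \<Longrightarrow> (\<phi> ^^ n) (ray x n) = x"
  using iterate_ray[of x n 0] by simp

lemma ray_notin_Per: "x \<in> carrier G - Per G \<phi> \<Longrightarrow> ray x n \<notin> Per G \<phi>"
  using iterate_Per[of "ray x n" n] iterate_ray_self by auto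

lemma ray_inj:
  assumes x: "x \<in> carrier G - Per G \<phi>"
  shows "inj (ray x)"
proof (rule linorder_injI)
  fix i j :: nat assume "i < j"
  show "ray x i \<noteq> ray x j"
  proof
    assume "ray x i = ray x j"
    moreover have "(\<phi> ^^ (j - i)) (ray x j) = ray x i"
      using iterate_ray[of x "j - i" i] x \<open>i < j\<close> by simp
    ultimately have "ray x i \<in> Per G \<phi>"
      using x \<open>i < j\<close> by (intro PerI[of _ "j - i"]) auto
    with ray_notin_Per[OF x] show False by blast
  qed
qed

lemma ray_string: "x \<in> carrier G - Per G \<phi> \<Longrightarrow> ray x \<in> strings G \<phi>"
  using ray_inj[of x] by (auto simp: strings_def gr0_conv_Suc)

text \<open>
  The pigeonhole principle of the proof. If two backward orbits meet, the starting point nearer to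
  the common element lies on the forward orbit of the other one. So if no two points of the sequence
  were related, their backward orbits would form an infinite disjoint family of strings.
\<close>

lemma forward_related:
  assumes fin: "string_number G \<phi> < \<infinity>"
    and u: "\<And>i. u i \<in> carrier G - Per G \<phi>"
  obtains i j :: nat and n where "i \<noteq> j" "(\<phi> ^^ n) (u i) = u j"
proof (rule ccontr)
  assume "\<not> thesis"
  with that have neq: "(\<phi> ^^ n) (u i) \<noteq> u j" if "i \<noteq> j" for i j n
    using that by blast
  have le: "False" if "i \<noteq> j" "ray (u i) d = ray (u j) e" "d \<le> e" for i j d e
  proof -
    have "(\<phi> ^^ (e - d)) (u i) = (\<phi> ^^ (e - d)) ((\<phi> ^^ d) (ray (u i) d))"
      using u by (simp add: iterate_ray_self)
    also have "\<dots> = (\<phi> ^^ e) (ray (u j) e)"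
      using that(2,3) by (simp add: iterate_add)
    also have "\<dots> = u j"
      using u by (simp add: iterate_ray_self)
    finally show False using neq that(1) by blast
  qed
  have disj: "range (ray (u i)) \<inter> range (ray (u j)) = {}" if "i \<noteq> j" for i j
  proof -
    have "ray (u i) d \<noteq> ray (u j) e" for d e
      using le[of i j d e] le[of j i e d] that by (metis nat_le_linear)
    then show ?thesis by auto
  qed
  define F where "F = range (\<lambda>i. ray (u i))"
  have "inj (\<lambda>i. ray (u i))"
    using disj by (intro injI) (metis Int_absorb empty_not_UNIV image_is_empty)
  then have "infinite F"
    unfolding F_def by (rule range_inj_infinite)
  moreover have "F \<subseteq> strings G \<phi>"
    using ray_string u by (auto simp: F_def)
  moreover have "disjoint_family_on range F"
    unfolding disjoint_family_on_def
  proof (intro ballI impI)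
    fix r s assume "r \<in> F" "s \<in> F" "r \<noteq> s"
    then obtain i j where "r = ray (u i)" "s = ray (u j)" "i \<noteq> j"
      by (auto simp: F_def)
    with disj show "range r \<inter> range s = {}" by blast
  qed
  ultimately have "\<infinity> \<in> {ecard F |F. F \<subseteq> strings G \<phi> \<and> disjoint_family_on range F}"
    unfolding ecard_def by (intro CollectI exI[of _ F]) simp
  then have "\<infinity> \<le> string_number G \<phi>"
    unfolding string_number_def by (rule Sup_upper)
  with fin show False by simp
qed

text \<open>
  A nontrivial kernel element \<open>k\<close> produces, at each term of the backward orbit of \<open>x\<close>, a
  second preimage. An iterate carrying one of these to another moves down the backward orbit of
  \<open>x\<close> after its first step. It meets no other branching preimage before it reaches \<open>x\<close>, and
  after passing \<open>x\<close> it can no longer return to a point above \<open>x\<close>, since \<open>x\<close> is not periodic.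
\<close>

lemma kernel_trivial:
  assumes fin: "string_number G \<phi> < \<infinity>"
    and x: "x \<in> carrier G - Per G \<phi>"
    and k: "k \<in> carrier G" "\<phi> k = \<one>"
  shows "k = \<one>"
proof (rule ccontr)
  assume "k \<noteq> \<one>"
  define z where "z n = ray x (Suc n) \<otimes> k" for n
  have z_closed: "z n \<in> carrier G" for n
    using x k by (simp add: z_def)
  have \<phi>z: "\<phi> (z n) = ray x n" for n
    using x k hom_mult[OF endo, of "ray x (Suc n)" k] by (simp add: z_def)
  have z_neq: "z n \<noteq> ray x (Suc n)" for n
    using x k \<open>k \<noteq> \<one>\<close> by (simp add: z_def)
  have "z n \<notin> Per G \<phi>" for n
    using iterate_Per[of "z n" 1] \<phi>z ray_notin_Per[OF x] by auto
  then obtain i j n where ij: "i \<noteq> j" "(\<phi> ^^ n) (z i) = z j"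
    using forward_related[OF fin, of z] z_closed by blast
  have "n \<noteq> 0"
    using ij \<phi>z ray_inj[OF x] by (metis funpow_0 injD)
  then obtain m where "n = Suc m" by (cases n) auto
  then have m: "(\<phi> ^^ m) (ray x i) = z j"
    using ij \<phi>z by (simp add: funpow_swap1)
  then have Sm: "(\<phi> ^^ Suc m) (ray x i) = ray x j"
    using \<phi>z by simp
  show False
  proof (cases "Suc m \<le> i")
    case True
    then have "(\<phi> ^^ Suc m) (ray x i) = ray x (i - Suc m)"
      using iterate_ray[of x "Suc m" "i - Suc m"] x by simp
    with Sm have "i - Suc m = j"
      using ray_inj[OF x] by (metis injD)
    with True have "i = m + Suc j" by simp
    then have "(\<phi> ^^ m) (ray x i) = ray x (Suc j)"
      using iterate_ray x by blast
    with m z_neq[of j] show False by simp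
  next
    case False
    have "(\<phi> ^^ (j + (Suc m - i))) x = (\<phi> ^^ (j + (Suc m - i))) ((\<phi> ^^ i) (ray x i))"
      using x by (simp add: iterate_ray_self)
    also have "\<dots> = (\<phi> ^^ j) ((\<phi> ^^ Suc m) (ray x i))"
      using False by (simp only: iterate_add) simp
    also have "\<dots> = x"
      using Sm x by (simp add: iterate_ray_self)
    finally show False
      using x False PerI[of x "j + (Suc m - i)"] by simp
  qed
qed

lemma inj_if_nonperiodic:
  assumes "string_number G \<phi> < \<infinity>" "x \<in> carrier G - Per G \<phi>"
  shows "inj_on \<phi> (carrier G)"
proof -
  interpret h: group_hom G G \<phi> using endo by unfold_locales
  show ?thesis
    unfolding h.inj_on_one_iff using kernel_trivial[OF assms] by blast
qed

lemma iterate_inj: "inj_on \<phi> (carrier G) \<Longrightarrow> inj_on (\<phi> ^^ n) (carrier G)"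
proof (induction n)
  case (Suc n)
  have "(\<phi> ^^ n) ` carrier G \<subseteq> carrier G" by auto
  with Suc have "inj_on (\<phi> \<circ> (\<phi> ^^ n)) (carrier G)"
    by (meson comp_inj_on inj_on_subset)
  then show ?case by (simp add: comp_def)
qed simp

section \<open>Torsion points are periodic\<close>

lemma Per_if_repeated:
  assumes inj: "inj_on \<phi> (carrier G)" and x: "x \<in> carrier G"
    and "m \<noteq> n" "(\<phi> ^^ m) x = (\<phi> ^^ n) x"
  shows "x \<in> Per G \<phi>"
  using assms(3,4)
proof (induction m n rule: linorder_wlog)
  case (le m n)
  then have "(\<phi> ^^ m) ((\<phi> ^^ (n - m)) x) = (\<phi> ^^ m) x"
    by (simp add: iterate_add)
  then have "(\<phi> ^^ (n - m)) x = x"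
    using iterate_inj[OF inj] x by (meson inj_onD iterate_closed)
  with x le show ?case by (intro PerI[of x "n - m"]) auto
qed auto

text \<open>
  The subgroup generated by the first \<open>n\<close> points of the forward orbit of \<open>z\<close>, presented as a
  product of cyclic groups so that its finiteness for torsion \<open>z\<close> can be read off by induction.
\<close>

primrec orbit_span :: "'a \<Rightarrow> nat \<Rightarrow> 'a set" where
  "orbit_span z 0 = {\<one>}"
| "orbit_span z (Suc n) = generate G {(\<phi> ^^ n) z} <#> orbit_span z n"

lemma orbit_span_subgroup: "z \<in> carrier G \<Longrightarrow> subgroup (orbit_span z n) G"
  by (induction n) (auto intro!: mult_subgroups generate_is_subgroup triv_subgroup)

lemma finite_orbit_span:
  assumes z: "z \<in> carrier G" "z [^] (k::nat) = \<one>" "k > 0"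
  shows "finite (orbit_span z n)"
proof (induction n)
  case (Suc n)
  have "(\<phi> ^^ n) z [^] k = \<one>"
    using z iterate_pow[of z n k] hom_one[OF iterate_hom] is_group by metis
  then have "ord ((\<phi> ^^ n) z) > 0"
    using z by (metis dvd_0_left_iff iterate_closed neq0_conv pow_eq_id)
  then have "finite (generate G {(\<phi> ^^ n) z})"
    using z by (metis generate_pow_card card.infinite iterate_closed less_irrefl)
  with Suc show ?case by (auto simp: set_mult_def)
qed simp

lemma orbit_span_mono:
  assumes "z \<in> carrier G" "m \<le> n"
  shows "orbit_span z m \<subseteq> orbit_span z n"
  using \<open>m \<le> n\<close>
proof (induction rule: dec_induct)
  case (step n)
  have "orbit_span z n \<subseteq> orbit_span z (Suc n)"
  proof
    fix a assume a: "a \<in> orbit_span z n"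
    then have "\<one> \<otimes> a \<in> orbit_span z (Suc n)"
      by (auto simp: set_mult_def intro: generate.one)
    moreover have "a \<in> carrier G"
      using subgroup.mem_carrier[OF orbit_span_subgroup[OF assms(1)] a] .
    ultimately show "a \<in> orbit_span z (Suc n)" by simp
  qed
  with step show ?case by blast
qed simp

lemma iterate_in_orbit_span:
  assumes "z \<in> carrier G" "i < n"
  shows "(\<phi> ^^ i) z \<in> orbit_span z n"
proof -
  have "(\<phi> ^^ i) z \<otimes> \<one> \<in> orbit_span z (Suc i)"
    using subgroup.one_closed[OF orbit_span_subgroup[OF assms(1)]]
    by (auto simp: set_mult_def intro: generate.incl simp del: r_one)
  then show ?thesis
    using orbit_span_mono[of z "Suc i" n] assms by (auto simp del: orbit_span.simps)
qed

lemma endo_orbit_span: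
  assumes z: "z \<in> carrier G"
  shows "\<phi> ` orbit_span z n \<subseteq> orbit_span z (Suc n)"
proof (induction n)
  case 0
  interpret h: group_hom G G \<phi> using endo by unfold_locales
  show ?case
    using subgroup.one_closed[OF orbit_span_subgroup[OF z], of "Suc 0"]
    by (simp del: orbit_span.simps(2))
next
  case (Suc n)
  interpret h: group_hom G G \<phi> using endo by unfold_locales
  show ?case
  proof
    fix y assume "y \<in> \<phi> ` orbit_span z (Suc n)"
    then obtain g a where g: "g \<in> generate G {(\<phi> ^^ n) z}" and a: "a \<in> orbit_span z n"
      and y: "y = \<phi> (g \<otimes> a)"
      by (auto simp: set_mult_def)
    have car: "g \<in> carrier G" "a \<in> carrier G"
      using g a z generate_in_carrier[of "{(\<phi> ^^ n) z}" g]
        subgroup.mem_carrier[OF orbit_span_subgroup[OF z]] by auto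
    have "\<phi> ` generate G {(\<phi> ^^ n) z} = generate G (\<phi> ` {(\<phi> ^^ n) z})"
      using h.generate_img[of "{(\<phi> ^^ n) z}"] z by simp
    with g have "\<phi> g \<in> generate G {(\<phi> ^^ Suc n) z}" by auto
    moreover have "\<phi> a \<in> orbit_span z (Suc n)" using Suc a by blast
    ultimately show "y \<in> orbit_span z (Suc (Suc n))"
      unfolding y h.hom_mult[OF car] orbit_span.simps(2)[of z "Suc n"] set_mult_def
      by (intro UN_I[of "\<phi> g"] UN_I[of "\<phi> a"]) simp_all
  qed
qed

text \<open>
  The relation makes the span of the first \<open>d\<close> iterates invariant under \<open>\<phi>\<close>. As \<open>z\<close> is
  torsion this span is finite, so the orbit of \<open>z\<close> repeats itself.
\<close>

lemma Per_if_monic_relation: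
  assumes inj: "inj_on \<phi> (carrier G)"
    and z: "z \<in> carrier G" "z [^] (k::nat) = \<one>" "k > 0"
    and rel: "(\<phi> ^^ d) z \<in> orbit_span z d"
  shows "z \<in> Per G \<phi>"
proof -
  note sub = orbit_span_subgroup[OF z(1), of d]
  have "generate G {(\<phi> ^^ d) z} \<subseteq> orbit_span z d"
    using rel sub by (simp add: generate_subgroup_incl)
  then have "orbit_span z (Suc d) \<subseteq> orbit_span z d"
    using subgroup.m_closed[OF sub] by (auto simp: set_mult_def)
  then have inv: "\<phi> ` orbit_span z d \<subseteq> orbit_span z d"
    using endo_orbit_span[OF z(1), of d] by blast
  have "(\<phi> ^^ n) ((\<phi> ^^ d) z) \<in> orbit_span z d" for n
    using rel inv by (induction n) auto
  then have "range (\<lambda>n. (\<phi> ^^ (n + d)) z) \<subseteq> orbit_span z d"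
    by (auto simp: funpow_add)
  then have "finite (range (\<lambda>n. (\<phi> ^^ (n + d)) z))"
    using finite_orbit_span[OF z] finite_subset by blast
  then have "\<not> inj (\<lambda>n. (\<phi> ^^ (n + d)) z)"
    using range_inj_infinite by blast
  then obtain m n where "m \<noteq> n" "(\<phi> ^^ (m + d)) z = (\<phi> ^^ (n + d)) z"
    unfolding inj_def by blast
  then show ?thesis
    using Per_if_repeated[OF inj z(1), of "m + d" "n + d"] by simp
qed

lemma Per_if_binomials_agree:
  assumes inj: "inj_on \<phi> (carrier G)"
    and z: "z \<in> carrier G" "z [^] (k::nat) = \<one>" "k > 0"
    and eq: "(\<phi> ^^ a) z \<otimes> (\<phi> ^^ b) z = (\<phi> ^^ c) z \<otimes> (\<phi> ^^ d) z"
    and ord: "a < b" "c < d" "b < d"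
  shows "z \<in> Per G \<phi>"
proof (rule Per_if_monic_relation[OF inj z])
  have "(\<phi> ^^ d) z = inv ((\<phi> ^^ c) z) \<otimes> ((\<phi> ^^ a) z \<otimes> (\<phi> ^^ b) z)"
    using z(1) by (simp add: eq m_assoc[symmetric])
  also have "\<dots> \<in> orbit_span z d"
    using orbit_span_subgroup[OF z(1), of d] iterate_in_orbit_span[OF z(1)] ord
    by (auto intro!: subgroup.m_closed subgroup.m_inv_closed)
  finally show "(\<phi> ^^ d) z \<in> orbit_span z d" .
qed

text \<open>
  The points \<open>u b\<close> below are used for their two free exponents: an equality between iterates of
  them, or between one of them and an iterate of itself, is always a relation between two binomials
  in \<open>\<phi>\<close>. The relation is solvable for the largest exponent unless the two largest exponents
  coincide, and then cancellation leaves two equal iterates of \<open>z\<close>.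
\<close>

lemma torsion_Per:
  assumes fin: "string_number G \<phi> < \<infinity>"
    and z: "z \<in> carrier G" "z [^] (k::nat) = \<one>" "k > 0"
  shows "z \<in> Per G \<phi>"
proof (rule ccontr)
  assume nonper: "z \<notin> Per G \<phi>"
  have inj: "inj_on \<phi> (carrier G)"
    using inj_if_nonperiodic[OF fin] z nonper by blast
  note no_rel = Per_if_binomials_agree[OF inj z, THEN notE[OF nonper]]
  define u where "u b = z \<otimes> (\<phi> ^^ Suc b) z" for b
  have u_closed: "u b \<in> carrier G" for b
    using z by (simp add: u_def del: funpow.simps)
  have iter_u: "(\<phi> ^^ n) (u b) = (\<phi> ^^ n) z \<otimes> (\<phi> ^^ (n + Suc b)) z" for n b
    using z by (simp add: u_def iterate_mult iterate_add del: funpow.simps)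
  have "u b \<notin> Per G \<phi>" for b
  proof
    assume "u b \<in> Per G \<phi>"
    then obtain p where "p > 0" "(\<phi> ^^ p) (u b) = u b" by (rule PerE)
    then show False
      using no_rel[of 0 "Suc b" p "p + Suc b"] iter_u[of p b] by (simp add: u_def)
  qed
  then obtain i j n where ij: "i \<noteq> j" "(\<phi> ^^ n) (u i) = u j"
    using forward_related[OF fin, of u] u_closed by blast
  then have eq: "(\<phi> ^^ n) z \<otimes> (\<phi> ^^ (n + Suc i)) z = (\<phi> ^^ 0) z \<otimes> (\<phi> ^^ Suc j) z"
    by (simp only: iter_u) (simp add: u_def)
  consider "n + Suc i < Suc j" | "Suc j < n + Suc i" | "n + Suc i = Suc j" by linarith
  then show False
  proof cases
    case 1
    from no_rel[OF eq] 1 show False by simp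
  next
    case 2
    from no_rel[OF eq[symmetric]] 2 show False by simp
  next
    case 3
    with eq have "(\<phi> ^^ n) z = (\<phi> ^^ 0) z"
      using z by (simp del: funpow.simps)
    moreover have "n \<noteq> 0" using 3 ij by auto
    ultimately show False
      using Per_if_repeated[OF inj z(1)] nonper by blast
  qed
qed

text \<open>
  An iterate of \<open>\<phi>\<close> fixes \<open>x [^] k\<close>, so it moves \<open>x\<close> by a \<open>k\<close>-torsion point, which is
  periodic. A further iterate then is \<open>x \<mapsto> x \<otimes> w\<close> with \<open>w\<close> both fixed and \<open>k\<close>-torsion, and
  its \<open>k\<close>-th power fixes \<open>x\<close>.
\<close>

lemma Per_if_pow_Per:
  assumes fin: "string_number G \<phi> < \<infinity>"
    and x: "x \<in> carrier G" and k: "k > (0::nat)" and per: "x [^] k \<in> Per G \<phi>"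
  shows "x \<in> Per G \<phi>"
proof -
  obtain p where p: "p > 0" "(\<phi> ^^ p) (x [^] k) = x [^] k"
    using per by (rule PerE)
  define z where "z = inv x \<otimes> (\<phi> ^^ p) x"
  have z: "z \<in> carrier G" using x by (simp add: z_def)
  have "z [^] k = inv (x [^] k) \<otimes> (\<phi> ^^ p) x [^] k"
    using x by (simp add: z_def nat_pow_distrib nat_pow_inv)
  also have "\<dots> = \<one>"
    using x p by (simp add: iterate_pow)
  finally have zk: "z [^] k = \<one>" .
  then have "z \<in> Per G \<phi>"
    using torsion_Per[OF fin z] k by blast
  then obtain q where q: "q > 0" "(\<phi> ^^ q) z = z" by (rule PerE)
  have step: "(\<phi> ^^ p) x = x \<otimes> z"
    using x by (simp add: z_def m_assoc[symmetric])
  have z_fixed: "(\<phi> ^^ (p * q)) z = z"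
    using iterate_fixed[OF q(2), of p] by (simp add: mult.commute)
  have "\<exists>w \<in> carrier G. (\<phi> ^^ (p * n)) x = x \<otimes> w \<and> w [^] k = \<one> \<and> (\<phi> ^^ (p * q)) w = w" for n
  proof (induction n)
    case 0
    then show ?case
      using x hom_one[OF iterate_hom] is_group by (intro bexI[of _ \<one>]) auto
  next
    case (Suc n)
    then obtain w where w: "w \<in> carrier G" "(\<phi> ^^ (p * n)) x = x \<otimes> w" "w [^] k = \<one>"
      "(\<phi> ^^ (p * q)) w = w" by blast
    \<comment> \<open>Iterating this recursion, the displacement after \<open>n\<close> steps is the product of the first \<open>n\<close>
      images of \<open>z\<close> under powers of \<open>\<phi> ^^ p\<close>, so it inherits exponent and period from \<open>z\<close>.\<close>
    define v where "v = z \<otimes> (\<phi> ^^ p) w"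
    have "v \<in> carrier G" using w z by (simp add: v_def)
    moreover have "(\<phi> ^^ (p * Suc n)) x = x \<otimes> v"
    proof -
      have "(\<phi> ^^ (p * Suc n)) x = (\<phi> ^^ p) (x \<otimes> w)"
        using w(2) by (simp add: funpow_add)
      also have "\<dots> = x \<otimes> v"
        using x w z by (simp add: iterate_mult step m_assoc v_def)
      finally show ?thesis .
    qed
    moreover have "v [^] k = \<one>"
      using z w zk hom_one[OF iterate_hom] is_group
      by (simp add: v_def nat_pow_distrib iterate_pow[symmetric])
    moreover have "(\<phi> ^^ (p * q)) ((\<phi> ^^ p) w) = (\<phi> ^^ p) ((\<phi> ^^ (p * q)) w)"
      by (simp only: iterate_add add.commute)
    then have "(\<phi> ^^ (p * q)) v = v"
      using z w z_fixed by (simp add: v_def iterate_mult)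
    ultimately show ?case by blast
  qed
  then obtain w where w: "w \<in> carrier G" "(\<phi> ^^ (p * q)) x = x \<otimes> w" "w [^] k = \<one>"
    "(\<phi> ^^ (p * q)) w = w" by blast
  have "(\<phi> ^^ (p * q * n)) x = x \<otimes> w [^] n" for n
  proof (induction n)
    case (Suc n)
    have "(\<phi> ^^ (p * q * Suc n)) x = (\<phi> ^^ (p * q)) (x \<otimes> w [^] n)"
      using Suc by (simp add: funpow_add)
    also have "\<dots> = x \<otimes> w [^] Suc n"
      using x w by (simp add: iterate_mult iterate_pow m_assoc m_comm m_lcomm)
    finally show ?case .
  qed (use x in simp)
  from this[of k] w(3) x have "(\<phi> ^^ (p * q * k)) x = x" by simp
  then show ?thesis
    using x p(1) q(1) k by (intro PerI[of x "p * q * k"]) auto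
qed

section \<open>Points of infinite order\<close>

lemma pow_eq_cancel:
  assumes fin: "string_number G \<phi> < \<infinity>" and x: "x \<in> carrier G - Per G \<phi>"
    and eq: "x [^] (m::nat) = x [^] n"
  shows "m = n"
proof -
  have "\<not> m < n" if "x [^] (m::nat) = x [^] n" for m n
    using pow_eq_div2[of x n m] torsion_Per[OF fin, of x "n - m"] x that by auto
  from this[OF eq] this[OF eq[symmetric]] show ?thesis by simp
qed

text \<open>
  Additively, \<open>x\<close> is an eigenvector of an iterate of \<open>\<phi>\<close> for the eigenvalue
  \<open>b^j / b^i\<close>, which differs from 1 when \<open>b > 1\<close>; the denominator is cleared because \<open>G\<close> need not
  admit division.
\<close>

lemma rational_eigenvector:
  assumes fin: "string_number G \<phi> < \<infinity>" and x: "x \<in> carrier G - Per G \<phi>" and "b > (0::nat)"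
  obtains i j n where "i \<noteq> j" "(\<phi> ^^ n) x [^] (b ^ i) = x [^] (b ^ j)"
proof -
  have "x [^] (b ^ i) \<in> carrier G - Per G \<phi>" for i
  proof -
    have "x [^] (b ^ i) \<notin> Per G \<phi>"
      using Per_if_pow_Per[OF fin, of x "b ^ i"] x \<open>b > 0\<close> by (metis DiffD1 DiffD2 zero_less_power)
    with x show ?thesis by simp
  qed
  then obtain i j n where "i \<noteq> j" "(\<phi> ^^ n) (x [^] (b ^ i)) = x [^] (b ^ j)"
    by (rule forward_related[OF fin])
  with x show ?thesis
    by (intro that[of i j n]) (simp_all add: iterate_pow)
qed

lemma iterate_eigenvector:
  assumes x: "x \<in> carrier G" and eq: "(\<phi> ^^ n) x [^] (a::nat) = x [^] (b::nat)"
  shows "(\<phi> ^^ (n * m)) x [^] (a ^ m) = x [^] (b ^ m)"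
proof (induction m)
  case (Suc m)
  have "(\<phi> ^^ (n * Suc m)) x [^] (a ^ Suc m) = ((\<phi> ^^ n) ((\<phi> ^^ (n * m)) x [^] (a ^ m))) [^] a"
    using x by (simp add: iterate_pow funpow_add nat_pow_pow mult.commute)
  also have "\<dots> = ((\<phi> ^^ n) x [^] a) [^] (b ^ m)"
    using x Suc by (simp add: iterate_pow nat_pow_pow mult.commute)
  also have "\<dots> = x [^] (b ^ Suc m)"
    using x eq by (simp add: nat_pow_pow)
  finally show ?case .
qed (use x in simp)

text \<open>
  With \<open>x\<close> an eigenvector of \<open>\<phi> ^^ n\<close> for a rational power of 2 and of \<open>\<phi> ^^ m\<close> for one of 3,
  it is an eigenvector of \<open>\<phi> ^^ (n * m)\<close> for the respective powers of both.
  These agree since nonperiodic points have infinite order, so both are 1, which forces \<open>m = 0\<close>.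
  But then the eigenvalue of the identity is a nontrivial power of 3.
\<close>

lemma all_periodic_if_finite:
  assumes fin: "string_number G \<phi> < \<infinity>"
  shows "carrier G = Per G \<phi>"
proof (rule ccontr)
  assume "carrier G \<noteq> Per G \<phi>"
  then obtain x where x: "x \<in> carrier G - Per G \<phi>"
    by (auto elim: PerE)
  then have xc: "x \<in> carrier G" by simp
  obtain i j n where ij: "i \<noteq> j" and two: "(\<phi> ^^ n) x [^] ((2::nat) ^ i) = x [^] ((2::nat) ^ j)"
    using rational_eigenvector[OF fin x, of 2] by auto
  obtain k l m where kl: "k \<noteq> l" and three: "(\<phi> ^^ m) x [^] ((3::nat) ^ k) = x [^] ((3::nat) ^ l)"
    using rational_eigenvector[OF fin x, of 3] by auto
  define y where "y = (\<phi> ^^ (n * m)) x"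
  have y: "y \<in> carrier G" using xc by (simp add: y_def)
  have y2: "y [^] ((2::nat) ^ (i * m)) = x [^] ((2::nat) ^ (j * m))"
    using iterate_eigenvector[OF xc two, of m] by (simp add: y_def power_mult)
  have y3: "y [^] ((3::nat) ^ (k * n)) = x [^] ((3::nat) ^ (l * n))"
    using iterate_eigenvector[OF xc three, of n] by (simp add: y_def power_mult mult.commute)
  have "x [^] ((2::nat) ^ (j * m) * 3 ^ (k * n)) = (y [^] ((2::nat) ^ (i * m))) [^] ((3::nat) ^ (k * n))"
    using xc by (simp add: y2 nat_pow_pow)
  also have "\<dots> = (y [^] ((3::nat) ^ (k * n))) [^] ((2::nat) ^ (i * m))"
    using y by (simp add: nat_pow_pow mult.commute)
  also have "\<dots> = x [^] ((2::nat) ^ (i * m) * 3 ^ (l * n))"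
    using xc by (simp add: y3 nat_pow_pow mult.commute)
  finally have "(2::nat) ^ (j * m) * 3 ^ (k * n) = 2 ^ (i * m) * 3 ^ (l * n)"
    by (rule pow_eq_cancel[OF fin x])
  then have "j * m = i * m"
    using pow2_mult_pow3_unique by blast
  then have "m = 0" using ij by simp
  with three xc have "x [^] ((3::nat) ^ k) = x [^] ((3::nat) ^ l)" by simp
  then have "(3::nat) ^ k = 3 ^ l" by (rule pow_eq_cancel[OF fin x])
  with kl show False by simp
qed

section \<open>The equivalence\<close>

lemma no_strings_if_all_periodic:
  assumes "carrier G = Per G \<phi>"
  shows "strings G \<phi> = {}"
proof (rule ccontr)
  assume "strings G \<phi> \<noteq> {}"
  then obtain x :: "nat \<Rightarrow> 'a"
    where x: "range x \<subseteq> carrier G" "inj x" "\<forall>n>0. \<phi> (x n) = x (n - 1)"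
    unfolding strings_def by blast
  have down: "(\<phi> ^^ n) (x n) = x 0" for n
    by (induction n) (simp_all add: x(3) funpow_swap1)
  obtain p where p: "p > 0" "(\<phi> ^^ p) (x 0) = x 0"
    using x(1) assms PerE[of "x 0" thesis] by blast
  obtain q where q: "q > 0" "(\<phi> ^^ q) (x p) = x p"
    using x(1) assms PerE[of "x p" thesis] by blast
  obtain r where r: "q = Suc r" using q(1) by (cases q) auto
  have "x p = (\<phi> ^^ (p * q)) (x p)"
    using iterate_fixed[OF q(2), of p] by (simp add: mult.commute)
  also have "\<dots> = (\<phi> ^^ (p * r)) ((\<phi> ^^ p) (x p))"
    by (simp add: iterate_add r add.commute)
  also have "\<dots> = x 0"
    using iterate_fixed[OF p(2), of r] by (simp add: down)
  finally show False
    using x(2) p(1) by (metis injD less_irrefl)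
qed

lemma string_number_eq_0:
  assumes "carrier G = Per G \<phi>"
  shows "string_number G \<phi> = 0"
  using no_strings_if_all_periodic[OF assms]
  by (simp add: string_number_def ecard_def disjoint_family_on_def flip: zero_enat_def)

end

theorem mainTheorem4:
  fixes G :: "('a, 'b) monoid_scheme" and \<phi> :: "'a \<Rightarrow> 'a"
  assumes "comm_group G"
    and "\<phi> \<in> hom G G"
    and "\<phi> ` carrier G = carrier G"
  shows "(string_number G \<phi> = 0 \<longleftrightarrow> string_number G \<phi> < \<infinity>) \<and>
         (string_number G \<phi> < \<infinity> \<longleftrightarrow> carrier G = Per G \<phi>)"
proof -
  interpret surjective_endomorphism G \<phi>
    using assms by (simp add: surjective_endomorphism_def surjective_endomorphism_axioms_def)
  have "string_number G \<phi> < \<infinity>" if "string_number G \<phi> = 0"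
    using that by (simp add: zero_enat_def)
  with all_periodic_if_finite string_number_eq_0 show ?thesis by blast
qed

end
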